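(* Let $n\ge 2$, let $\Sigma=\Sigma_1\uplus\cdots\uplus\Sigma_n$ be a finite alphabet partitioned into pairwise disjoint location alphabets, let $\mathcal{A}$ be an NFA over $\Sigma$ with a unique initial state, and let $(\mu_1,\ldots,\mu_n)$ be a multitrace, i.e. $\mu_i\in\Sigma_i^*$ for every $i\in\{1,\ldots,n\}$. Then the centralized procedure (defined in the context) run on $\mathcal{A}$ and $(\mu_i)_{i=1}^n$ is sound and complete: it answers $\texttt{Pass}$ if and only if there exists an interleaving of $\mu_1,\ldots,\mu_n$ that is accepted by $\mathcal{A}$, i.e. if and only if $(\mu_1\mathbin{\sqcup\!\sqcup}\cdots\mathbin{\sqcup\!\sqcup}\mu_n)\cap\mathcal{L}(\mathcal{A})\neq\emptyset$; otherwise it answers $\texttt{Error}$.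
   Context: An NFA is $\mathcal{A}=(Q,\Sigma,\delta,Q_0,F)$ with finite state set $Q$, finite alphabet $\Sigma$, transitions $\delta\subseteq Q\times\Sigma\times Q$ (no $\varepsilon$-transitions), initial states $Q_0\subseteq Q$, final states $F\subseteq Q$; $\delta(q,a)$ is the set of states reachable from $q$ by one $a$-transition. $\mathcal{L}(\mathcal{A})$ is the set of words read by a path from an initial state to a final state. $\varepsilon$ is the empty word. For languages $L_1,L_2$ over alphabets $\Sigma_1,\Sigma_2$, the shuffle $L_1\mathbin{\sqcup\!\sqcup} L_2$ is the set of words $u_1v_1u_2v_2\ldots u_kv_k$ with $u_j\in\Sigma_1^*$, $v_j\in\Sigma_2^*$, $u_1\ldots u_k\in L_1$, $v_1\ldots v_k\in L_2$; it is extended to $n$ languages by $L_1\mathbin{\sqcup\!\sqcup}\cdots\mathbin{\sqcup\!\sqcup} L_{k+1}=(L_1\mathbin{\sqcup\!\sqcup}\cdots\mathbin{\sqcup\!\sqcup} L_k)\mathbin{\sqcup\!\sqcup} L_{k+1}$. A word $\mu_i$ is identified with the singleton language $\{\mu_i\}$, so $\mu_1\mathbin{\sqcup\!\sqcup}\cdots\mathbin{\sqcup\!\sqcup}\mu_n$ is the set of interleavings of $\mu_1,\ldots,\mu_n$. $\mathsf{suf}(w)$ is the set of suffixes of $w$ (including $w$ and $\varepsilon$). For $\mathcal{A}=(Q^{\mathcal{A}},\Sigma,\delta^{\mathcal{A}},\{q_0^{\mathcal{A}}\},F^{\mathcal{A}})$, the NFA $\mathsf{Central}(\mathcal{A},(\mu_i)_i)=(Q,\Sigma,\delta,\{q_0\},F)$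 is defined by: - $Q=\mathsf{suf}(\mu_1)\times\cdots\times\mathsf{suf}(\mu_n)\times Q^{\mathcal{A}}$; - $(w_1,\ldots,w_n,q)\xrightarrow{a}(w_1',\ldots,w_n',q')$ is in $\delta$ iff $q'\in\delta^{\mathcal{A}}(q,a)$ and there exists $i$ such that $w_i=aw_i'$ and $w_j=w_j'$ for all $j\ne i$; - $q_0=(\mu_1,\ldots,\mu_n,q_0^{\mathcal{A}})$ and $F=\{(\varepsilon,\ldots,\varepsilon,q)\mid q\in F^{\mathcal{A}}\}$. Centralized procedure: build the states of $\mathsf{Central}(\mathcal{A},(\mu_i)_i)$ starting from the initial state $q_0$, repeatedly building the states reachable in one transition from states already built. If a final state is built (including the initial state, if it is final), stop and answer $\texttt{Pass}$; otherwise, once all reachable states have been built, answer $\texttt{Error}$. *)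

theory Defs
  imports Main "HOL-Library.Sublist"
begin

section \<open>Nondeterministic finite automata\<close>

record ('q, 'a) nfa =
  states   :: "'q set"
  alphabet :: "'a set"
  trans    :: "('q \<times> 'a \<times> 'q) set"
  inits    :: "'q set"
  finals   :: "'q set"

definition is_nfa :: "('q, 'a) nfa \<Rightarrow> bool" where
  "is_nfa A \<longleftrightarrow> finite (states A) \<and> finite (alphabet A)
     \<and> trans A \<subseteq> states A \<times> alphabet A \<times> states A
     \<and> inits A \<subseteq> states A \<and> finals A \<subseteq> states A"

inductive nfa_path :: "('q, 'a) nfa \<Rightarrow> 'q \<Rightarrow> 'a list \<Rightarrow> 'q \<Rightarrow> bool" for A where
  nil: "q \<in> states A \<Longrightarrow> nfa_path A q [] q"
| step: "(p, a, q) \<in> trans A \<Longrightarrow> nfa_path A q w r \<Longrightarrow> nfa_path A p (a # w) r"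

definition lang :: "('q, 'a) nfa \<Rightarrow> 'a list set" where
  "lang A = {w. \<exists>p \<in> inits A. \<exists>q \<in> finals A. nfa_path A p w q}"

section \<open>Shuffle\<close>

text \<open>The factors automatically range over words of the two alphabets, because their
  concatenations lie in the two languages.\<close>

definition shuffle :: "'a list set \<Rightarrow> 'a list set \<Rightarrow> 'a list set" where
  "shuffle L1 L2 = {concat (map2 (@) us vs) | us vs.
     length us = length vs \<and> concat us \<in> L1 \<and> concat vs \<in> L2}"

text \<open>Left-associated iterated shuffle; the value on the empty list is the neutral element.\<close>

fun shuffle_list :: "'a list set list \<Rightarrow> 'a list set" where
  "shuffle_list [] = {[]}"
| "shuffle_list (L # Ls) = foldl shuffle L Ls"

definition interleavings :: "'a list list \<Rightarrow> 'a list set" where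
  "interleavings mus = shuffle_list (map (\<lambda>mu. {mu}) mus)"

text \<open>Agreement with the shuffle of two words from the library.\<close>

lemma shuffles_append:
  "w \<in> shuffles xs ys \<Longrightarrow> u @ v @ w \<in> shuffles (u @ xs) (v @ ys)"
proof -
  assume w: "w \<in> shuffles xs ys"
  have v: "v @ w \<in> shuffles xs (v @ ys)"
    using w by (induction v) (simp_all add: Cons_in_shuffles_rightI)
  show "u @ v @ w \<in> shuffles (u @ xs) (v @ ys)"
    using v by (induction u) (simp_all add: Cons_in_shuffles_leftI)
qed

lemma shuffle_eq_shuffles: "shuffle L1 L2 = (\<Union>u\<in>L1. \<Union>v\<in>L2. shuffles u v)"
proof -
  have 1: "concat (map2 (@) us vs) \<in> shuffles (concat us) (concat vs)"
    if "length us = length vs" for us vs :: "'a list list"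
    using that by (induction us vs rule: list_induct2) (simp_all add: shuffles_append)
  have 2: "\<exists>us vs. length us = length vs \<and> concat us = u \<and> concat vs = v
      \<and> concat (map2 (@) us vs) = w" if "w \<in> shuffles u v" for u v w :: "'a list"
    using that
  proof (induction u v arbitrary: w rule: shuffles.induct)
    case (1 ys)
    then show ?case by (intro exI[of _ "[[]]"] exI[of _ "[ys]"]) auto
  next
    case (2 xs)
    then show ?case by (intro exI[of _ "[xs]"] exI[of _ "[[]]"]) auto
  next
    case (3 x xs y ys)
    from "3.prems" consider
        z where "w = x # z" "z \<in> shuffles xs (y # ys)"
      | z where "w = y # z" "z \<in> shuffles (x # xs) ys"
      by auto
    then show ?case
    proof cases
      case 1
      obtain us vs where "length us = length vs" "concat us = xs" "concat vs = y # ys"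
        "concat (map2 (@) us vs) = z" using "3.IH"(1)[OF 1(2)] by blast
      with 1 show ?thesis by (intro exI[of _ "[x] # us"] exI[of _ "[] # vs"]) simp
    next
      case 2
      obtain us vs where "length us = length vs" "concat us = x # xs" "concat vs = ys"
        "concat (map2 (@) us vs) = z" using "3.IH"(2)[OF 2(2)] by blast
      with 2 show ?thesis by (intro exI[of _ "[] # us"] exI[of _ "[y] # vs"]) simp
    qed
  qed
  show ?thesis
  proof (rule set_eqI, rule iffI)
    fix w assume "w \<in> shuffle L1 L2"
    then obtain us vs where w: "w = concat (map2 (@) us vs)" "length us = length vs"
      "concat us \<in> L1" "concat vs \<in> L2" unfolding shuffle_def by blast
    with 1[OF w(2)] show "w \<in> (\<Union>u\<in>L1. \<Union>v\<in>L2. shuffles u v)" by blast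
  next
    fix w assume "w \<in> (\<Union>u\<in>L1. \<Union>v\<in>L2. shuffles u v)"
    then obtain u v where uv: "u \<in> L1" "v \<in> L2" "w \<in> shuffles u v" by blast
    from 2[OF uv(3)] obtain us vs where "length us = length vs" "concat us = u" "concat vs = v"
      "concat (map2 (@) us vs) = w" by blast
    with uv show "w \<in> shuffle L1 L2" unfolding shuffle_def by blast
  qed
qed

section \<open>The automaton \<open>Central\<close>\<close>

text \<open>A state \<open>(w\<^sub>1, \<dots>, w\<^sub>n, q)\<close> is encoded as \<open>([w\<^sub>1, \<dots>, w\<^sub>n], q)\<close>.
  The use of \<open>the_elem\<close> presupposes that \<open>A\<close> has exactly one initial state.\<close>

definition central_states :: "('q, 'a) nfa \<Rightarrow> 'a list list \<Rightarrow> ('a list list \<times> 'q) set" where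
  "central_states A mus = {(ws, q). length ws = length mus
     \<and> (\<forall>i < length mus. suffix (ws ! i) (mus ! i)) \<and> q \<in> states A}"

definition central :: "('q, 'a) nfa \<Rightarrow> 'a list list \<Rightarrow> ('a list list \<times> 'q, 'a) nfa" where
  "central A mus = \<lparr>
     states = central_states A mus,
     alphabet = alphabet A,
     trans = {((ws, q), a, (ws', q')) | ws q a ws' q'.
       (ws, q) \<in> central_states A mus \<and> (ws', q') \<in> central_states A mus
       \<and> (q, a, q') \<in> trans A
       \<and> (\<exists>i < length mus. ws ! i = a # ws' ! i
             \<and> (\<forall>j < length mus. j \<noteq> i \<longrightarrow> ws ! j = ws' ! j))},
     inits = {(mus, the_elem (inits A))},
     finals = {(replicate (length mus) [], q) | q. q \<in> finals A}\<rparr>"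

section \<open>The centralized procedure\<close>

text \<open>A configuration of the procedure is the set \<open>B\<close> of states built so far. The order of
  exploration is left open: a step builds any nonempty set of not yet built successors of built
  states, which covers one-by-one, depth-first and layer-by-layer exploration. No step is taken
  once a final state has been built.\<close>

datatype answer = Pass | Error

definition successors :: "('s, 'a) nfa \<Rightarrow> 's set \<Rightarrow> 's set" where
  "successors C B = {s'. \<exists>s \<in> B. \<exists>a. (s, a, s') \<in> trans C}"

definition explore_step :: "('s, 'a) nfa \<Rightarrow> 's set \<Rightarrow> 's set \<Rightarrow> bool" where
  "explore_step C B B' \<longleftrightarrow> B \<inter> finals C = {}
     \<and> (\<exists>N. N \<noteq> {} \<and> N \<subseteq> successors C B - B \<and> B' = B \<union> N)"

inductive halts_with :: "('s, 'a) nfa \<Rightarrow> 's set \<Rightarrow> answer \<Rightarrow> bool" for C where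
  pass: "B \<inter> finals C \<noteq> {} \<Longrightarrow> halts_with C B Pass"
| error: "B \<inter> finals C = {} \<Longrightarrow> successors C B \<subseteq> B \<Longrightarrow> halts_with C B Error"

lemma halts_iff_no_step: "(\<exists>r. halts_with C B r) \<longleftrightarrow> \<not> (\<exists>B'. explore_step C B B')"
proof -
  have "(\<exists>B'. explore_step C B B') \<longleftrightarrow> B \<inter> finals C = {} \<and> \<not> successors C B \<subseteq> B"
  proof
    assume "B \<inter> finals C = {} \<and> \<not> successors C B \<subseteq> B"
    then have "explore_step C B (B \<union> (successors C B - B))"
      unfolding explore_step_def by (intro conjI exI[of _ "successors C B - B"]) auto
    then show "\<exists>B'. explore_step C B B'" ..
  qed (auto simp: explore_step_def)
  moreover have "(\<exists>r. halts_with C B r) \<longleftrightarrow> B \<inter> finals C \<noteq> {} \<or> successors C B \<subseteq> B"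
    by (metis halts_with.simps)
  ultimately show ?thesis by metis
qed

text \<open>The procedure answers \<open>r\<close> if, whatever the order of exploration, it terminates
  and its answer is \<open>r\<close>.\<close>

definition exploration_answers :: "('s, 'a) nfa \<Rightarrow> answer \<Rightarrow> bool" where
  "exploration_answers C r \<longleftrightarrow>
     (\<nexists>Bs :: nat \<Rightarrow> 's set. Bs 0 = inits C \<and> (\<forall>k. explore_step C (Bs k) (Bs (Suc k))))
     \<and> (\<forall>B r'. (explore_step C)\<^sup>*\<^sup>* (inits C) B \<and> halts_with C B r' \<longrightarrow> r' = r)"

definition centralized_answers :: "('q, 'a) nfa \<Rightarrow> 'a list list \<Rightarrow> answer \<Rightarrow> bool" where
  "centralized_answers A mus r \<longleftrightarrow> exploration_answers (central A mus) r"

text \<open>Such an answer is really produced by some execution, hence it is unique.\<close>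

lemma exploration_answers_halts:
  assumes "exploration_answers C r"
  shows "\<exists>B. (explore_step C)\<^sup>*\<^sup>* (inits C) B \<and> halts_with C B r"
proof (rule ccontr)
  assume no: "\<not> ?thesis"
  have ex: "\<exists>B'. explore_step C B B'"
    if "(explore_step C)\<^sup>*\<^sup>* (inits C) B" for B
    using assms no that halts_iff_no_step[of C B]
    unfolding exploration_answers_def by blast
  let ?R = "\<lambda>B. (explore_step C)\<^sup>*\<^sup>* (inits C) B"
  obtain Bs where "Bs 0 = inits C" "\<And>k. explore_step C (Bs k) (Bs (Suc k))"
  proof -
    have "\<exists>Bs. \<forall>k. (?R (Bs k) \<and> (k = 0 \<longrightarrow> Bs k = inits C)) \<and> explore_step C (Bs k) (Bs (Suc k))"
    proof (rule dependent_nat_choice)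
      show "\<exists>B. ?R B \<and> ((0::nat) = 0 \<longrightarrow> B = inits C)" by blast
    next
      fix B and k :: nat
      assume "?R B \<and> (k = 0 \<longrightarrow> B = inits C)"
      with ex obtain B' where B': "?R B" "explore_step C B B'" by blast
      then have "?R B'" by (rule rtranclp.rtrancl_into_rtrancl)
      with B' show "\<exists>B'. (?R B' \<and> (Suc k = 0 \<longrightarrow> B' = inits C)) \<and> explore_step C B B'" by blast
    qed
    then show ?thesis using that by blast
  qed
  with assms show False unfolding exploration_answers_def by blast
qed

lemma exploration_answers_unique:
  "exploration_answers C r \<Longrightarrow> exploration_answers C r' \<Longrightarrow> r = r'"
  using exploration_answers_halts[of C r] unfolding exploration_answers_def by blast

end

(* A run of Central from (mu_1, ..., mu_n, q_0) to a final state reading w is the same thing as a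
   run of A on w together with a choice, letter by letter, of the component from which the letter
   is taken. Hence Central accepts exactly the interleavings accepted by A. Each exploration step
   enlarges the built subset of a finite state set, so it ends; the built states stay reachable,
   and when no step is left they contain every reachable state or already a final one. *)
theory Submission
  imports Defs
begin

section \<open>Interleavings read letter by letter\<close>

lemma interleavings_Nil: "interleavings [] = {[]}"
  by (simp add: interleavings_def)

text \<open>Since the iterated shuffle associates to the left, the last word is the one that splits
  off; this is why inductions over the list of words run in reverse. For empty \<open>mus\<close>
  the neutral language \<open>{[]}\<close> gives the right value.\<close>

lemma interleavings_snoc:
  "interleavings (mus @ [mu]) = (\<Union>u\<in>interleavings mus. shuffles u mu)"
  by (cases mus) (simp_all add: interleavings_def shuffle_eq_shuffles)

lemma Nil_in_interleavings_iff: "[] \<in> interleavings mus \<longleftrightarrow> set mus \<subseteq> {[]}"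
  by (induction mus rule: rev_induct) (auto simp: interleavings_Nil interleavings_snoc)

lemma Cons_in_shuffles_cases:
  "a # w \<in> shuffles u v \<longleftrightarrow>
     (\<exists>u'. u = a # u' \<and> w \<in> shuffles u' v) \<or> (\<exists>v'. v = a # v' \<and> w \<in> shuffles u v')"
  by (cases u; cases v) auto

text \<open>This mirrors one transition of \<open>central\<close>: the first letter is consumed from
  exactly one component. In the induction it comes either from the last word or from an interleaving
  of the earlier ones.\<close>

lemma Cons_in_interleavings_iff:
  "a # w \<in> interleavings mus \<longleftrightarrow>
     (\<exists>i v. i < length mus \<and> mus ! i = a # v \<and> w \<in> interleavings (mus[i := v]))"
proof (induction mus arbitrary: w rule: rev_induct)
  case Nil
  then show ?case by (simp add: interleavings_Nil)
next
  case (snoc mu mus)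
  have "a # w \<in> interleavings (mus @ [mu]) \<longleftrightarrow>
      (\<exists>u'. a # u' \<in> interleavings mus \<and> w \<in> shuffles u' mu)
    \<or> (\<exists>v. mu = a # v \<and> w \<in> interleavings (mus @ [v]))"
    by (auto simp: interleavings_snoc Cons_in_shuffles_cases)
  also have "(\<exists>u'. a # u' \<in> interleavings mus \<and> w \<in> shuffles u' mu) \<longleftrightarrow>
      (\<exists>i v. i < length mus \<and> mus ! i = a # v \<and> w \<in> interleavings (mus[i := v] @ [mu]))"
    unfolding snoc.IH interleavings_snoc by blast
  \<comment> \<open>Positions below \<open>Suc (length mus)\<close> split into earlier ones and
    \<open>length mus\<close> itself, and the update acts on the matching part of the
    append.\<close>
  also have "\<dots> \<or> (\<exists>v. mu = a # v \<and> w \<in> interleavings (mus @ [v])) \<longleftrightarrow>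
      (\<exists>i v. i < length (mus @ [mu]) \<and> (mus @ [mu]) ! i = a # v
        \<and> w \<in> interleavings ((mus @ [mu])[i := v]))"
    by (auto simp: less_Suc_eq nth_append list_update_append)
  finally show ?case .
qed

section \<open>Runs of \<open>Central\<close>\<close>

lemma nfa_path_Nil_iff: "nfa_path A p [] q \<longleftrightarrow> p = q \<and> q \<in> states A"
  by (auto elim: nfa_path.cases intro: nfa_path.nil)

lemma nfa_path_Cons_iff:
  "nfa_path A p (a # w) r \<longleftrightarrow> (\<exists>q. (p, a, q) \<in> trans A \<and> nfa_path A q w r)"
  by (auto elim: nfa_path.cases intro: nfa_path.step)

text \<open>Paths grow at the front by definition, whereas exploration extends them at the
  end.\<close>

lemma nfa_path_snoc:
  assumes "nfa_path A p w q" "(q, a, r) \<in> trans A" "r \<in> states A"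
  shows "nfa_path A p (w @ [a]) r"
  using assms by (induction rule: nfa_path.induct) (auto intro: nfa_path.intros)

text \<open>Removing the first letter of a suffix leaves a suffix, and transitions of
  \<open>A\<close> end in states of \<open>A\<close>, so the target is automatically a state of
  \<open>central A mus\<close>. The list update matches
  \<open>Cons_in_interleavings_iff\<close>.\<close>

lemma trans_central_iff:
  assumes "is_nfa A" and "(ws, q) \<in> central_states A mus"
  shows "((ws, q), a, (ws', q')) \<in> trans (central A mus) \<longleftrightarrow>
    (q, a, q') \<in> trans A \<and> (\<exists>i v. i < length ws \<and> ws ! i = a # v \<and> ws' = ws[i := v])"
  (is "?L \<longleftrightarrow> ?R")
proof
  assume L: ?L
  then obtain i where i: "i < length mus" "ws ! i = a # ws' ! i"
      "\<forall>j < length mus. j \<noteq> i \<longrightarrow> ws ! j = ws' ! j"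
    by (auto simp: central_def)
  from L have len: "length ws' = length mus" "length ws = length mus"
    by (auto simp: central_def central_states_def)
  with i have "ws' = ws[i := ws' ! i]"
    by (intro nth_equalityI) (auto simp: nth_list_update)
  with L i len show ?R by (auto simp: central_def)
next
  assume R: ?R
  then obtain i v where i: "i < length ws" "ws ! i = a # v" "ws' = ws[i := v]" by blast
  from assms(2) have ws: "length ws = length mus"
      "\<forall>j < length mus. suffix (ws ! j) (mus ! j)"
    by (auto simp: central_states_def)
  with i have "suffix v (mus ! i)" by (metis suffix_ConsD)
  moreover from assms(1) R have "q' \<in> states A" by (auto simp: is_nfa_def)
  ultimately have "(ws', q') \<in> central_states A mus"
    using i ws by (auto simp: central_states_def nth_list_update)
  moreover have "i < length mus" "ws ! i = a # ws' ! i"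
      "\<forall>j < length mus. j \<noteq> i \<longrightarrow> ws ! j = ws' ! j"
    using i ws by auto
  ultimately show ?L using R assms(2) by (auto simp: central_def)
qed

lemma trans_central_states:
  "(s, a, s') \<in> trans (central A mus) \<Longrightarrow> s' \<in> central_states A mus"
  by (auto simp: central_def)

text \<open>The start is an arbitrary state, not just the initial one, because the induction on
  \<open>w\<close> moves to the target of the first transition.\<close>

lemma nfa_path_central_iff:
  assumes "is_nfa A" and "(ws, q) \<in> central_states A mus"
  shows "nfa_path (central A mus) (ws, q) w (replicate (length mus) [], r) \<longleftrightarrow>
    w \<in> interleavings ws \<and> nfa_path A q w r"
  using assms(2)
proof (induction w arbitrary: ws q)
  case Nil
  then have len: "length ws = length mus" by (simp add: central_states_def)
  have "ws = replicate (length mus) [] \<longleftrightarrow> set ws \<subseteq> {[]}"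
  proof
    assume "ws = replicate (length mus) []"
    then show "set ws \<subseteq> {[]}" by (metis in_set_replicate singletonI subsetI)
  next
    assume "set ws \<subseteq> {[]}"
    then have "\<And>v. v \<in> set ws \<Longrightarrow> v = []" by blast
    with len show "ws = replicate (length mus) []" by (rule replicate_eqI)
  qed
  moreover have "(ws, q) \<in> states (central A mus)" and "q \<in> states A"
    using Nil by (simp_all add: central_def central_states_def)
  ultimately show ?case
    unfolding nfa_path_Nil_iff Nil_in_interleavings_iff by blast
next
  case (Cons a w)
  \<comment> \<open>The induction hypothesis speaks only of states of \<open>central A mus\<close>;
    keeping the transition as a conjunct guarantees that \<open>(ws', q')\<close> is one.\<close>
  have "((ws, q), a, (ws', q')) \<in> trans (central A mus)
        \<and> nfa_path (central A mus) (ws', q') w (replicate (length mus) [], r)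
      \<longleftrightarrow> ((ws, q), a, (ws', q')) \<in> trans (central A mus)
        \<and> w \<in> interleavings ws' \<and> nfa_path A q' w r" for ws' q'
    using Cons.IH[of ws' q'] trans_central_states[of "(ws, q)" a "(ws', q')" A mus] by blast
  then have "nfa_path (central A mus) (ws, q) (a # w) (replicate (length mus) [], r) \<longleftrightarrow>
      (\<exists>ws' q'. ((ws, q), a, (ws', q')) \<in> trans (central A mus)
        \<and> w \<in> interleavings ws' \<and> nfa_path A q' w r)"
    by (simp add: nfa_path_Cons_iff)
  also have "\<dots> \<longleftrightarrow> a # w \<in> interleavings ws \<and> nfa_path A q (a # w) r"
    unfolding trans_central_iff[OF assms(1) Cons.prems] Cons_in_interleavings_iff
      nfa_path_Cons_iff by auto
  finally show ?case .
qed

lemma init_in_central_states: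
  "inits A = {q0} \<Longrightarrow> q0 \<in> states A \<Longrightarrow> (mus, the_elem (inits A)) \<in> central_states A mus"
  by (simp add: central_states_def)

lemma lang_central:
  assumes "is_nfa A" and "inits A = {q0}"
  shows "lang (central A mus) = interleavings mus \<inter> lang A"
proof -
  from assms have "(mus, q0) \<in> central_states A mus"
    using init_in_central_states[of A q0 mus] by (auto simp: is_nfa_def)
  from nfa_path_central_iff[OF assms(1) this] show ?thesis
    using assms(2) by (auto simp: lang_def central_def)
qed

text \<open>The word components are lists of fixed length over the finite set of all suffixes of the
  given words.\<close>

lemma finite_central_states:
  assumes "finite (states A)"
  shows "finite (central_states A mus)"
proof (rule finite_subset)
  let ?S = "\<Union>mu \<in> set mus. set (suffixes mu)"
  have "set ws \<subseteq> ?S" if "length ws = length mus"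
    and "\<forall>i < length mus. suffix (ws ! i) (mus ! i)" for ws
  proof
    fix v assume "v \<in> set ws"
    with that obtain i where "i < length mus" "suffix v (mus ! i)"
      by (auto simp: in_set_conv_nth)
    then show "v \<in> ?S" by auto
  qed
  then show "central_states A mus \<subseteq> {ws. set ws \<subseteq> ?S \<and> length ws = length mus} \<times> states A"
    unfolding central_states_def by blast
  show "finite ({ws. set ws \<subseteq> ?S \<and> length ws = length mus} \<times> states A)"
    using assms by (intro finite_cartesian_product finite_lists_length_eq) auto
qed

lemma is_nfa_central:
  assumes "is_nfa A" and "inits A = {q0}"
  shows "is_nfa (central A mus)"
  using assms finite_central_states[of A mus] init_in_central_states[of A q0 mus]
  by (auto simp: is_nfa_def central_def) (auto simp: central_states_def)

section \<open>Exploration of an arbitrary automaton\<close>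

lemma exploration_terminates:
  assumes "is_nfa C"
  shows "\<nexists>Bs :: nat \<Rightarrow> 's set. Bs 0 = inits C \<and> (\<forall>k. explore_step C (Bs k) (Bs (Suc k)))"
proof
  assume "\<exists>Bs :: nat \<Rightarrow> 's set. Bs 0 = inits C \<and> (\<forall>k. explore_step C (Bs k) (Bs (Suc k)))"
  then obtain Bs where Bs: "Bs 0 = inits C" "\<And>k. explore_step C (Bs k) (Bs (Suc k))" by blast
  have sub: "Bs k \<subseteq> states C" for k
  proof (induction k)
    case 0
    then show ?case using assms Bs(1) by (auto simp: is_nfa_def)
  next
    case (Suc k)
    from assms have "successors C (Bs k) \<subseteq> states C"
      by (auto simp: is_nfa_def successors_def)
    with Suc Bs(2)[of k] show ?case unfolding explore_step_def by blast
  qed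
  have fin: "finite (states C)" using assms by (simp add: is_nfa_def)
  have psub: "Bs k \<subset> Bs (Suc k)" for k
    using Bs(2)[of k] by (auto simp: explore_step_def)
  have "k \<le> card (Bs k)" for k
  proof (induction k)
    case (Suc k)
    have "card (Bs k) < card (Bs (Suc k))"
      using psub sub fin by (meson finite_subset psubset_card_mono)
    with Suc show ?case by simp
  qed simp
  moreover have "card (Bs k) \<le> card (states C)" for k
    using sub fin by (rule card_mono[rotated])
  \<comment> \<open>The lower bound holds for every \<open>k\<close>, so it can be taken at one more
    than the number of states.\<close>
  ultimately have "Suc (card (states C)) \<le> card (states C)" by (rule le_trans)
  then show False by simp
qed

text \<open>This is the invariant of exploration: reachability justifies the answer
  \<open>Pass\<close>, and keeping the initial states lets closure under successors justify
  \<open>Error\<close>.\<close>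

lemma explored_reachable:
  assumes "is_nfa C" and "(explore_step C)\<^sup>*\<^sup>* (inits C) B"
  shows "inits C \<subseteq> B \<and> (\<forall>s \<in> B. \<exists>p \<in> inits C. \<exists>w. nfa_path C p w s)"
  using assms(2)
proof (induction rule: rtranclp_induct)
  case base
  from assms(1) have "nfa_path C s [] s" if "s \<in> inits C" for s
    using that by (auto simp: is_nfa_def intro: nfa_path.nil)
  then show ?case by blast
next
  case (step B B')
  have "\<exists>p \<in> inits C. \<exists>w. nfa_path C p w s" if "s \<in> successors C B" for s
  proof -
    from that obtain t a where t: "t \<in> B" "(t, a, s) \<in> trans C"
      by (auto simp: successors_def)
    with assms(1) have "s \<in> states C" by (auto simp: is_nfa_def)
    with t step.IH show ?thesis by (meson nfa_path_snoc)
  qed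
  with step show ?case unfolding explore_step_def by blast
qed

lemma nfa_path_in_closed:
  "nfa_path C p w s \<Longrightarrow> p \<in> B \<Longrightarrow> successors C B \<subseteq> B \<Longrightarrow> s \<in> B"
  by (induction rule: nfa_path.induct) (auto simp: successors_def)

lemma halts_with_sound:
  assumes "is_nfa C" and "(explore_step C)\<^sup>*\<^sup>* (inits C) B" and "halts_with C B r"
  shows "r = (if lang C \<noteq> {} then Pass else Error)"
  using assms(3)
proof cases
  case pass
  with explored_reachable[OF assms(1,2)] have "lang C \<noteq> {}" unfolding lang_def by blast
  with pass show ?thesis by simp
next
  case error
  have "lang C = {}"
  proof (rule ccontr)
    assume "lang C \<noteq> {}"
    then obtain p w s where "p \<in> inits C" "s \<in> finals C" "nfa_path C p w s"
      by (auto simp: lang_def)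
    then show False
      \<comment> \<open>An accepting path starts in \<open>B\<close> and cannot leave it, so its
        final state would have been built.\<close>
      using nfa_path_in_closed[of C p w s B] explored_reachable[OF assms(1,2)] error by blast
  qed
  with error show ?thesis by simp
qed

text \<open>Termination and \<open>halts_with_sound\<close> show that the answer determined by the
  language is given; uniqueness excludes the other one.\<close>

lemma exploration_answers_iff:
  assumes "is_nfa C"
  shows "exploration_answers C r \<longleftrightarrow> r = (if lang C \<noteq> {} then Pass else Error)"
proof -
  have "exploration_answers C (if lang C \<noteq> {} then Pass else Error)"
    using exploration_terminates[OF assms] halts_with_sound[OF assms]
    unfolding exploration_answers_def by blast
  then show ?thesis using exploration_answers_unique by blast
qed

theorem mainTheorem1:
  fixes n :: nat
    and Sigmas :: "'a set list"
    and A :: "('q, 'a) nfa"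
    and mus :: "'a list list"
  assumes "n \<ge> 2"
    and "length Sigmas = n"
    and "\<forall>i < n. \<forall>j < n. i \<noteq> j \<longrightarrow> Sigmas ! i \<inter> Sigmas ! j = {}"
    and "is_nfa A"
    and "alphabet A = (\<Union>i < n. Sigmas ! i)"
    and "\<exists>q0. inits A = {q0}"
    and "length mus = n"
    and "\<forall>i < n. mus ! i \<in> lists (Sigmas ! i)"
  shows "(centralized_answers A mus Pass \<longleftrightarrow> interleavings mus \<inter> lang A \<noteq> {})
    \<and> (\<not> (interleavings mus \<inter> lang A \<noteq> {}) \<longrightarrow> centralized_answers A mus Error)"
proof -
  from assms(6) obtain q0 where q0: "inits A = {q0}" ..
  show ?thesis
    unfolding centralized_answers_def exploration_answers_iff[OF is_nfa_central[OF assms(4) q0]]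
      lang_central[OF assms(4) q0] by simp
qed

end
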